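(* Let $S_{[1]},S_{[2]},\dots,S_{[t]}\in\mathcal S$ be distinct sets and let $\delta_{[i]}$ denote the $\delta$ variable associated with $S_{[i]}$. Let $S'\subseteq J$. Then the inequality $$-\sum_{j\in S'}z_j+\bigl(|S'\cup S_{[1]}|-n+l\bigr)\delta_{[1]}+\sum_{i=2}^t\Bigl|S_{[i]}\setminus\Bigl(S'\cup\bigcup_{k=1}^{i-1}S_{[k]}\Bigr)\Bigr|\,\delta_{[i]}\ \le\ 0$$ is valid for $\operatorname{conv}(X^{l,u})$, provided that $\min_{i=2,\dots,t}|S'\cup(S_{[1]}\cap S_{[i]})|\ge n-l$.
   Context: Let $n,m$ be positive integers, $J=\{1,\dots,n\}$, $I=\{1,\dots,m\}$, and let $l,u$ be integers with $0\le l\le u$ and $u\ge2$. Let $S_1,\dots,S_m$ be distinct subsets of $J$ with $1\le|S_i|\le n-l$ for all $i\in I$ (not necessarily nested), and $\mathcal S=\{S_i\}_{i\in I}$. Define $$X^{l,u}=\Bigl\{(z,\delta)\in\{0,1\}^n\times\{0,1\}^m:\ \delta_i=\prod_{j\in S_i}(1-z_j)\ (i\in I),\ l\le\sum_{j\in J}z_j\le u\Bigr\}.$$ *)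

theory Defs
  imports "HOL-Analysis.Analysis"
begin

text \<open>
  The index sets \<open>J = {1, \<dots>, n}\<close> and \<open>I = {1, \<dots>, m}\<close> are rendered as the
  nonempty finite types \<open>'n\<close> and \<open>'m\<close>, so that \<open>n = CARD('n)\<close> and \<open>m = CARD('m)\<close>.
\<close>

definition Xlu :: "('m::finite \<Rightarrow> 'n::finite set) \<Rightarrow> int \<Rightarrow> int \<Rightarrow> ((real^'n) \<times> (real^'m)) set" where
  "Xlu S l u = {(z, \<delta>).
     (\<forall>j. z $ j \<in> {0, 1}) \<and> (\<forall>i. \<delta> $ i \<in> {0, 1}) \<and>
     (\<forall>i. \<delta> $ i = (\<Prod>j\<in>S i. 1 - z $ j)) \<and>
     of_int l \<le> (\<Sum>j\<in>UNIV. z $ j) \<and> (\<Sum>j\<in>UNIV. z $ j) \<le> of_int u}"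

end

theory Submission
  imports Defs
begin

text \<open>
  The left-hand side is linear, so validity on the convex hull follows from validity at the points
  of \<^const>\<open>Xlu\<close>. At such a point let \<open>W\<close> be the set of indices with \<open>z j = 0\<close>, and
  write \<open>S i\<close> and \<open>\<delta> i\<close> for the set and the variable that \<open>\<sigma>\<close> selects at position \<open>i\<close>. Then
  \<open>\<delta> i = 1\<close> holds exactly when \<open>S i \<subseteq> W\<close>, the lower bound on the number of ones says
  \<open>card W \<le> n - l\<close>, and the sum of \<open>z\<close> over \<open>S'\<close> is \<open>card (S' - W)\<close>.

  The terms with \<open>i \<ge> 2\<close> and \<open>\<delta> i = 1\<close> count pairwise disjoint subsets of \<open>W\<close>,
  all of which avoid \<open>S' \<union> S 1\<close>. For any \<open>C \<subseteq> W \<inter> S 1\<close> they are therefore disjoint from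
  \<open>S' \<union> C\<close> too, and everything fits inside \<open>S' \<union> W\<close>, a set of size
  \<open>card (S' - W) + card W \<le> card (S' - W) + n - l\<close>; this is \<open>card_first_occurrences_le\<close>.
  If \<open>\<delta> 1 = 1\<close>, the choice \<open>C = S 1\<close> is the inequality. If \<open>\<delta> 1 = 0\<close> and some
  \<open>\<delta> i = 1\<close> with \<open>i \<ge> 2\<close>, then \<open>C = S 1 \<inter> S i\<close> is admissible, and the proviso
  \<open>card (S' \<union> C) \<ge> n - l\<close> cancels the slack \<open>n - l\<close>. If all \<open>\<delta> i\<close> vanish, the
  inequality is trivial.
\<close>

text \<open>
  The differences on the left are disjoint because each element is counted only at its first
  occurrence. The set \<open>C\<close> is left free since the two cases \<open>\<delta> 1 = 1\<close> and
  \<open>\<delta> 1 = 0\<close> use different ones.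
\<close>
lemma card_first_occurrences_le:
  fixes T :: "nat \<Rightarrow> 'a::finite set"
  assumes A: "A \<subseteq> {2..t}" and TW: "\<And>i. i \<in> A \<Longrightarrow> T i \<subseteq> W" and C: "C \<subseteq> W \<inter> T 1"
  shows "(\<Sum>i\<in>A. card (T i - (S' \<union> (\<Union>k\<in>{1..i-1}. T k)))) + card (S' \<union> C)
           \<le> card W + card (S' - W)"
proof -
  define D where "D i = T i - (S' \<union> (\<Union>k\<in>{1..i-1}. T k))" for i
  have finA: "finite A"
    using A finite_subset by blast
  have earlier: "D i \<inter> D j = {}" if "i \<in> A" "i < j" for i j
    using that A by (fastforce simp: D_def)
  have disj: "D i \<inter> D j = {}" if "i \<in> A" "j \<in> A" "i \<noteq> j" for i j
    using that earlier[of i j] earlier[of j i] by (cases "i < j") auto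
  have D_sub: "D i \<subseteq> W - (S' \<union> T 1)" if "i \<in> A" for i
    using that A TW[OF that] by (fastforce simp: D_def)
  have "(\<Sum>i\<in>A. card (D i)) + card (S' \<union> C) = card (\<Union>i\<in>A. D i) + card (S' \<union> C)"
    using finA disj by (simp add: card_UN_disjoint)
  also have "\<dots> = card ((\<Union>i\<in>A. D i) \<union> (S' \<union> C))"
  proof (intro card_Un_disjoint[symmetric])
    show "(\<Union>i\<in>A. D i) \<inter> (S' \<union> C) = {}"
      using D_sub C by blast
  qed simp_all
  also have "\<dots> \<le> card (W \<union> (S' - W))"
    using D_sub C by (intro card_mono) auto
  also have "\<dots> = card W + card (S' - W)"
    by (intro card_Un_disjoint) auto
  finally show ?thesis
    by (simp add: D_def)
qed

lemma prod_one_minus_binary: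
  fixes x :: "'a \<Rightarrow> real"
  assumes "finite B" and "\<And>j. x j \<in> {0, 1}"
  shows "(\<Prod>j\<in>B. 1 - x j) = of_bool (B \<subseteq> {j. x j = 0})"
proof (cases "B \<subseteq> {j. x j = 0}")
  case True
  then show ?thesis by (auto intro!: prod.neutral)
next
  case False
  then have "\<exists>j\<in>B. 1 - x j = 0" using assms(2) by fastforce
  then show ?thesis using False assms(1) by (simp add: prod_zero)
qed

lemma sum_binary:
  fixes x :: "'a \<Rightarrow> real"
  assumes "finite B" and "\<And>j. x j \<in> {0, 1}"
  shows "(\<Sum>j\<in>B. x j) = card (B - {j. x j = 0})"
proof -
  have "(\<Sum>j\<in>B. x j) = (\<Sum>j\<in>B - {j. x j = 0}. x j)"
    using assms(1) by (intro sum.mono_neutral_right) auto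
  also have "\<dots> = (\<Sum>j\<in>B - {j. x j = 0}. 1)"
    using assms(2) by (intro sum.cong) fastforce+
  finally show ?thesis by simp
qed

theorem proposition21:
  fixes S :: "'m::finite \<Rightarrow> 'n::finite set"
    and l u :: int
    and t :: nat
    and \<sigma> :: "nat \<Rightarrow> 'm"
    and S' :: "'n set"
  assumes "0 \<le> l" and "l \<le> u" and "2 \<le> u"
    and "inj S"
    and "\<And>i. 1 \<le> card (S i)"
    and "\<And>i. int (card (S i)) \<le> int CARD('n) - l"
    and "1 \<le> t"
    and "inj_on \<sigma> {1..t}"
    and "\<forall>i\<in>{2..t}. int (card (S' \<union> (S (\<sigma> 1) \<inter> S (\<sigma> i)))) \<ge> int CARD('n) - l"
  shows "\<forall>(z, \<delta>) \<in> convex hull (Xlu S l u).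
    - (\<Sum>j\<in>S'. z $ j)
    + real_of_int (int (card (S' \<union> S (\<sigma> 1))) - int CARD('n) + l) * \<delta> $ \<sigma> 1
    + (\<Sum>i=2..t. real (card (S (\<sigma> i) - (S' \<union> (\<Union>k\<in>{1..i-1}. S (\<sigma> k))))) * \<delta> $ \<sigma> i)
    \<le> 0"
proof -
  define c where "c i = card (S (\<sigma> i) - (S' \<union> (\<Union>k\<in>{1..i-1}. S (\<sigma> k))))" for i
  define d where "d = int (card (S' \<union> S (\<sigma> 1))) - int CARD('n) + l"
  define f :: "(real^'n) \<times> (real^'m) \<Rightarrow> real" where
    "f p = - (\<Sum>j\<in>S'. fst p $ j) + d * snd p $ \<sigma> 1 + (\<Sum>i=2..t. c i * snd p $ \<sigma> i)" for p
  have "linear f"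
    by (rule linearI) (simp_all add: f_def algebra_simps sum.distrib sum_distrib_left)
  then have "convex (f -` {..0})"
    by (intro convex_linear_vimage) auto
  moreover have "Xlu S l u \<subseteq> f -` {..0}"
  proof
    fix p assume "p \<in> Xlu S l u"
    then obtain z \<delta> where p: "p = (z, \<delta>)"
      and z: "\<And>j. z $ j \<in> {0, 1}"
      and \<delta>_prod: "\<And>i. \<delta> $ i = (\<Prod>j\<in>S i. 1 - z $ j)"
      and l: "of_int l \<le> (\<Sum>j\<in>UNIV. z $ j)"
      by (auto simp: Xlu_def)
    define W where "W = {j. z $ j = 0}"
    define A where "A = {i\<in>{2..t}. S (\<sigma> i) \<subseteq> W}"
    have \<delta>: "\<delta> $ i = of_bool (S i \<subseteq> W)" for i
      unfolding \<delta>_prod W_def using z by (intro prod_one_minus_binary) auto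
    have zsum: "(\<Sum>j\<in>B. z $ j) = card (B - W)" for B
      unfolding W_def using z by (intro sum_binary) auto
    have "card (UNIV - W) + card W = CARD('n)"
      by (simp add: card_Diff_subset card_mono)
    then have W: "int (card W) \<le> int CARD('n) - l"
      using l zsum[of UNIV] by linarith
    have csum: "(\<Sum>i=2..t. c i * \<delta> $ \<sigma> i) = real (\<Sum>i\<in>A. c i)"
      unfolding A_def \<delta> of_nat_sum by (intro sum.mono_neutral_cong_right) auto
    have count: "(\<Sum>i\<in>A. c i) + card (S' \<union> C) \<le> card W + card (S' - W)"
      if "C \<subseteq> W \<inter> S (\<sigma> 1)" for C
      unfolding c_def using that
      by (intro card_first_occurrences_le[where T = "\<lambda>i. S (\<sigma> i)"]) (auto simp: A_def)
    have "d * of_bool (S (\<sigma> 1) \<subseteq> W) + int (\<Sum>i\<in>A. c i) \<le> int (card (S' - W))"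
    proof (cases "S (\<sigma> 1) \<subseteq> W")
      case True
      then show ?thesis
        using count[of "S (\<sigma> 1)"] W by (simp add: d_def del: of_nat_sum)
    next
      case False
      show ?thesis
      proof (cases "A = {}")
        case False
        then obtain i where i: "i \<in> {2..t}" "S (\<sigma> i) \<subseteq> W"
          by (auto simp: A_def)
        then have "int (card (S' \<union> (S (\<sigma> 1) \<inter> S (\<sigma> i)))) \<ge> int CARD('n) - l"
          using assms(9) by blast
        moreover have "(\<Sum>i\<in>A. c i) + card (S' \<union> (S (\<sigma> 1) \<inter> S (\<sigma> i))) \<le> card W + card (S' - W)"
          using i by (intro count) auto
        ultimately show ?thesis
          using W \<open>\<not> S (\<sigma> 1) \<subseteq> W\<close> by (simp del: of_nat_sum)
      qed (use False in simp)
    qed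
    then have "real_of_int (d * of_bool (S (\<sigma> 1) \<subseteq> W) + int (\<Sum>i\<in>A. c i))
                 \<le> real_of_int (int (card (S' - W)))"
      by (simp only: of_int_le_iff)
    then have "f (z, \<delta>) \<le> 0"
      unfolding f_def fst_conv snd_conv csum zsum by (simp add: \<delta>)
    then show "p \<in> f -` {..0}"
      by (simp add: p)
  qed
  ultimately have "convex hull (Xlu S l u) \<subseteq> f -` {..0}"
    by (rule hull_minimal[rotated])
  then show ?thesis
    by (auto simp: f_def c_def d_def)
qed

end
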